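(* Let $E$ be a topological vector space over $\mathbb{K}$, where $\mathbb{K}=\mathbb{R}$ or $\mathbb{K}=\mathbb{C}$. Then there is a family of pseudo-seminorms on $E$ such that the topology of $E$ is the topology defined by the family of pseudo-metrics associated to these pseudo-seminorms; consequently the topology of $E$ is uniformizable.
   Context: A pseudo-seminorm on a vector space $E$ over $\mathbb{K}$ is a map $\mathbf{x}\mapsto|\mathbf{x}|$ from $E$ to $\mathbb{R}$ such that: (i) $|\lambda\mathbf{x}|\le|\mathbf{x}|$ for all $\mathbf{x}\in E$ and all $\lambda\in\mathbb{K}$ with $|\lambda|\le1$; (ii) $|\mathbf{x}_1+\mathbf{x}_2|\le|\mathbf{x}_1|+|\mathbf{x}_2|$ for all $\mathbf{x}_1,\mathbf{x}_2\in E$; (iii) $|\mathbf{0}|=0$. A pseudo-seminorm is automatically nonnegative. The pseudo-metric associated to it is $(\mathbf{x}_1,\mathbf{x}_2)\mapsto|\mathbf{x}_1-\mathbf{x}_2|$, which is translation invariant. The topology defined by a family of pseudo-metrics is the topology of the uniformity generated by that family. Topological vector spaces are not assumed to be Hausdorff. *)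

theory Defs
  imports "HOL-Analysis.Analysis"
begin

section \<open>Topological vector spaces\<close>

text \<open>
  The vector space is a whole type, the topology an arbitrary topology on that type; it need not
  be Hausdorff.  The scalar field carries its usual topology; the intended instances of
  \<open>'k\<close> are \<^typ>\<open>real\<close> and \<^typ>\<open>complex\<close>.
\<close>

locale topological_vector_space = vector_space scale
  for scale :: "'k::real_normed_field \<Rightarrow> 'a::ab_group_add \<Rightarrow> 'a" +
  fixes T :: "'a topology"
  assumes topspace_eq: "topspace T = UNIV"
    and continuous_add: "continuous_map (prod_topology T T) T (\<lambda>(x, y). x + y)"
    and continuous_scale: "continuous_map (prod_topology euclidean T) T (\<lambda>(c, x). scale c x)"


section \<open>Pseudo-seminorms\<close>

locale pseudo_seminorm = vector_space scale
  for scale :: "'k::real_normed_field \<Rightarrow> 'a::ab_group_add \<Rightarrow> 'a" +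
  fixes p :: "'a \<Rightarrow> real"
  assumes scale_le: "norm c \<le> 1 \<Longrightarrow> p (scale c x) \<le> p x"
    and add_le: "p (x + y) \<le> p x + p y"
    and zero: "p 0 = 0"

definition pseudometric_of :: "('a::ab_group_add \<Rightarrow> real) \<Rightarrow> 'a \<Rightarrow> 'a \<Rightarrow> real" where
  "pseudometric_of p = (\<lambda>x y. p (x - y))"

context pseudo_seminorm
begin

lemma nonneg: "0 \<le> p x"
  using scale_le[of 0 x] zero by simp

lemma pseudometric_of_refl: "pseudometric_of p x x = 0"
  by (simp add: pseudometric_of_def zero)

lemma pseudometric_of_sym: "pseudometric_of p x y = pseudometric_of p y x"
proof -
  have "p (- z) \<le> p z" for z
    using scale_le[of "-1" z] by simp
  from this[of "x - y"] this[of "y - x"] show ?thesis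
    by (simp add: pseudometric_of_def)
qed

lemma pseudometric_of_triangle:
  "pseudometric_of p x z \<le> pseudometric_of p x y + pseudometric_of p y z"
  using add_le[of "x - y" "y - z"] by (simp add: pseudometric_of_def)

end


section \<open>Uniformities and the topologies they define\<close>

text \<open>
  A uniformity is a filter on \<open>'a \<times> 'a\<close>, as in the class \<^class>\<open>uniform_space\<close>, and its open sets
  are defined as in that class.  The class itself admits only one topology per type, so
  its underlying predicate \<^const>\<open>class.uniform_space\<close> is used instead.
\<close>

definition uniformity_topology :: "('a \<times> 'a) filter \<Rightarrow> 'a topology" where
  "uniformity_topology \<U> =
     topology (\<lambda>S. \<forall>x\<in>S. eventually (\<lambda>(x', y). x' = x \<longrightarrow> y \<in> S) \<U>)"

lemma openin_uniformity_topology: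
  "openin (uniformity_topology \<U>) S \<longleftrightarrow>
     (\<forall>x\<in>S. eventually (\<lambda>(x', y). x' = x \<longrightarrow> y \<in> S) \<U>)"
proof -
  have "istopology (\<lambda>S. \<forall>x\<in>S. eventually (\<lambda>(x', y). x' = x \<longrightarrow> y \<in> S) \<U>)"
    unfolding istopology_def
  proof (intro conjI allI impI ballI)
    fix S T x
    assume "\<forall>x\<in>S. eventually (\<lambda>(x', y). x' = x \<longrightarrow> y \<in> S) \<U>"
      and "\<forall>x\<in>T. eventually (\<lambda>(x', y). x' = x \<longrightarrow> y \<in> T) \<U>" and "x \<in> S \<inter> T"
    then have "eventually (\<lambda>(x', y). x' = x \<longrightarrow> y \<in> S) \<U>"
      and "eventually (\<lambda>(x', y). x' = x \<longrightarrow> y \<in> T) \<U>" by auto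
    then show "eventually (\<lambda>(x', y). x' = x \<longrightarrow> y \<in> S \<inter> T) \<U>"
      by eventually_elim auto
  next
    fix \<K> x
    assume "\<forall>K\<in>\<K>. \<forall>x\<in>K. eventually (\<lambda>(x', y). x' = x \<longrightarrow> y \<in> K) \<U>" and "x \<in> \<Union>\<K>"
    then obtain K where "K \<in> \<K>" and "eventually (\<lambda>(x', y). x' = x \<longrightarrow> y \<in> K) \<U>" by blast
    from this(2) show "eventually (\<lambda>(x', y). x' = x \<longrightarrow> y \<in> \<Union>\<K>) \<U>"
      by eventually_elim (use \<open>K \<in> \<K>\<close> in auto)
  qed
  then show ?thesis
    by (simp add: uniformity_topology_def topology_inverse')
qed

definition uniformizable :: "'a topology \<Rightarrow> bool" where
  "uniformizable T \<longleftrightarrow> (\<exists>\<U>. class.uniform_space (openin T) \<U>)"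

text \<open>
  The uniformity generated by a family of pseudo-metrics: the filter generated by the sets
  \<open>{(x, y). d x y < e}\<close>.  Infima in the order on \<^typ>\<open>'a filter\<close> are joins of filters viewed as
  families of sets.  The empty family gives the chaotic uniformity.
\<close>

definition pseudometrics_uniformity :: "('a \<Rightarrow> 'a \<Rightarrow> real) set \<Rightarrow> ('a \<times> 'a) filter" where
  "pseudometrics_uniformity D = (INF d\<in>D. INF e\<in>{0<..}. principal {(x, y). d x y < e})"

definition pseudometrics_topology :: "('a \<Rightarrow> 'a \<Rightarrow> real) set \<Rightarrow> 'a topology" where
  "pseudometrics_topology D = uniformity_topology (pseudometrics_uniformity D)"

end

theory Submission
  imports Defs
begin

text \<open>
  The topology of \<open>E\<close> is translation invariant, so it is determined by the neighbourhoods of \<open>0\<close>,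
  and the family can be taken to be as large as possible: all pseudo-seminorms whose balls
  \<open>{x. p x < e}\<close> are neighbourhoods of \<open>0\<close>.  The pseudometrics of these pseudo-seminorms define a
  topology that is coarser than the given one; it remains to find, inside every neighbourhood \<open>N\<close>
  of \<open>0\<close>, a ball of such a pseudo-seminorm (\<open>nbhd_0_contains_ball\<close>).

  For this, continuity of addition and of scalar multiplication at the origin produces balanced
  neighbourhoods \<open>U 0 = UNIV, U 1, U 2, \<dots>\<close> of \<open>0\<close>, all but the first inside \<open>N\<close>, with
  \<open>U (n+1) + U (n+1) + U (n+1) \<subseteq> U n\<close>.  Let \<open>level x\<close> be the infimum of the \<open>2\<^sup>-\<^sup>n\<close> with
  \<open>x \<in> U n\<close>.  It need not be subadditive, but the infimum \<open>chain_norm x\<close> of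
  \<open>level x\<^sub>1 + \<dots> + level x\<^sub>k\<close> over all decompositions \<open>x = x\<^sub>1 + \<dots> + x\<^sub>k\<close> is, and it inherits
  \<open>p (c x) \<le> p x\<close> for \<open>norm c \<le> 1\<close> from the balancedness of the sets \<open>U n\<close>.  Since
  \<open>chain_norm \<le> level\<close>, its balls are neighbourhoods of \<open>0\<close>.  The heart of the proof is Frink's
  chain argument (\<open>sum_list_mem\<close>): a decomposition of total level below \<open>2\<^sup>-\<^sup>n\<close> sums to an element
  of \<open>U n\<close>.  So passing to decompositions does not shrink the level too far, and the ball of
  radius \<open>1/2\<close> lies in \<open>U 1 \<subseteq> N\<close>.

  Uniformizability follows because every family of pseudometrics generates a uniformity.  The
  argument is the same for all normed fields that contain the reals.
\<close>

section \<open>The uniformity of a family of pseudometrics\<close>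

text \<open>
  The finite intersections of the entourages \<open>{(x, y). d x y < e}\<close> form a basis of the uniformity.
  One radius serves all members of a finite family, namely the least of the individual radii.
\<close>

lemma eventually_pseudometrics_uniformity:
  "eventually E (pseudometrics_uniformity D) \<longleftrightarrow>
     (\<exists>X e. finite X \<and> X \<subseteq> D \<and> 0 < e \<and> (\<forall>x y. (\<forall>d\<in>X. d x y < e) \<longrightarrow> E (x, y)))"
    (is "_ \<longleftrightarrow> ?R E D")
proof
  define G where
    "G d = (INF e\<in>{0<..}. principal {(x, y). d x y < e})" for d :: "'a \<Rightarrow> 'a \<Rightarrow> real"
  have G: "eventually E (G d) \<longleftrightarrow> (\<exists>e>0. \<forall>x y. d x y < e \<longrightarrow> E (x, y))" for d E
    unfolding G_def
  proof (subst eventually_INF_base)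
    fix a b :: real
    assume "a \<in> {0<..}" "b \<in> {0<..}"
    then show "\<exists>e\<in>{0<..}. principal {(x, y). d x y < e}
        \<le> inf (principal {(x, y). d x y < a}) (principal {(x, y). d x y < b})"
      by (intro bexI[of _ "min a b"]) auto
  qed (auto simp: eventually_principal)
  have fin: "?R E X" if "finite X" "eventually E (INF d\<in>X. G d)" for X E
    using that
  proof (induction X arbitrary: E rule: finite_induct)
    case empty
    then have "\<forall>x. E x" by simp
    then show ?case by (intro exI[of _ "{}"] exI[of _ 1]) auto
  next
    case (insert d X)
    from insert.prems obtain A B where A: "eventually A (G d)"
      and B: "eventually B (INF d\<in>X. G d)" and AB: "\<And>z. A z \<Longrightarrow> B z \<Longrightarrow> E z"
      by (auto simp: eventually_inf)
    from A obtain e1 where e1: "e1 > 0" "\<And>x y. d x y < e1 \<Longrightarrow> A (x, y)" by (auto simp: G)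
    from insert.IH[OF B] obtain Y e2 where Y: "finite Y" "Y \<subseteq> X" "e2 > 0"
      "\<And>x y. (\<forall>d\<in>Y. d x y < e2) \<Longrightarrow> B (x, y)" by blast
    show ?case
      using e1 Y AB
      by (intro exI[of _ "insert d Y"] exI[of _ "min e1 e2"]) auto
  qed
  assume "eventually E (pseudometrics_uniformity D)"
  then have "eventually E (INF d\<in>D. G d)"
    unfolding pseudometrics_uniformity_def G_def .
  from eventually_INF[THEN iffD1, OF this]
  obtain X where X: "finite X" "X \<subseteq> D" "eventually E (INF d\<in>X. G d)"
    by (elim exE conjE) (rule that)
  from fin[OF X(1,3)] X(2) show "?R E D" by blast
next
  assume "?R E D"
  then obtain X e where X: "finite X" "X \<subseteq> D" "0 < e"
    "\<And>x y. (\<forall>d\<in>X. d x y < e) \<Longrightarrow> E (x, y)" by blast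
  have "eventually (\<lambda>(x, y). d x y < e) (pseudometrics_uniformity D)" if "d \<in> X" for d
  proof -
    have "pseudometrics_uniformity D \<le> principal {(x, y). d x y < e}"
      unfolding pseudometrics_uniformity_def
      using that X by (intro INF_lower2[of d] INF_lower2[of e]) auto
    then show ?thesis
      by (auto simp: le_principal)
  qed
  then have "eventually (\<lambda>z. \<forall>d\<in>X. (case z of (x, y) \<Rightarrow> d x y < e)) (pseudometrics_uniformity D)"
    using X(1) by (intro eventually_ball_finite) auto
  then show "eventually E (pseudometrics_uniformity D)"
    by eventually_elim (use X(4) in auto)
qed

lemma openin_pseudometrics_topology:
  fixes D :: "('a \<Rightarrow> 'a \<Rightarrow> real) set"
  shows "openin (pseudometrics_topology D) S \<longleftrightarrow>
     (\<forall>x\<in>S. \<exists>X e. finite X \<and> X \<subseteq> D \<and> 0 < e \<and> (\<forall>y. (\<forall>d\<in>X. d x y < e) \<longrightarrow> y \<in> S))"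
proof -
  have "(\<forall>x' y. (\<forall>d\<in>X. d x' y < e) \<longrightarrow> x' = x \<longrightarrow> y \<in> S) \<longleftrightarrow>
      (\<forall>y. (\<forall>d\<in>X. d x y < e) \<longrightarrow> y \<in> S)" for X :: "('a \<Rightarrow> 'a \<Rightarrow> real) set" and x e
    by metis
  then show ?thesis
    unfolding pseudometrics_topology_def openin_uniformity_topology
      eventually_pseudometrics_uniformity by (simp only: prod.case)
qed

lemma uniformizable_pseudometrics_topology:
  assumes refl: "\<And>d x. d \<in> D \<Longrightarrow> d x x = 0"
    and sym: "\<And>d x y. d \<in> D \<Longrightarrow> d x y = d y x"
    and triangle: "\<And>d x y z. d \<in> D \<Longrightarrow> d x z \<le> d x y + d y z"
  shows "uniformizable (pseudometrics_topology D)"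
  unfolding uniformizable_def
proof (intro exI, unfold_locales)
  let ?F = "pseudometrics_uniformity D"
  show "openin (pseudometrics_topology D) S \<longleftrightarrow>
      (\<forall>x\<in>S. \<forall>\<^sub>F (x', y) in ?F. x' = x \<longrightarrow> y \<in> S)" for S
    by (simp add: pseudometrics_topology_def openin_uniformity_topology)
  fix E
  assume "eventually E ?F"
  then obtain X e where X: "finite X" "X \<subseteq> D" "0 < e"
    and E: "\<And>x y. (\<forall>d\<in>X. d x y < e) \<Longrightarrow> E (x, y)"
    unfolding eventually_pseudometrics_uniformity by blast
  show "E (x, x)" for x
    by (rule E) (simp add: refl[OF subsetD[OF X(2)]] X(3))
  have "E (y, x)" if "\<forall>d\<in>X. d x y < e" for x y
    by (rule E) (metis that X(2) sym subsetD)
  then show "\<forall>\<^sub>F (x, y) in ?F. E (y, x)"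
    unfolding eventually_pseudometrics_uniformity using X by auto
  show "\<exists>D'. eventually D' ?F \<and> (\<forall>x y z. D' (x, y) \<longrightarrow> D' (y, z) \<longrightarrow> E (x, z))"
  proof (intro exI conjI allI impI)
    let ?D = "\<lambda>(x, y). \<forall>d\<in>X. d x y < e / 2"
    show "eventually ?D ?F"
      unfolding eventually_pseudometrics_uniformity
      using X by (intro exI[of _ X] exI[of _ "e / 2"]) auto
    fix x y z
    assume xy: "?D (x, y)" and yz: "?D (y, z)"
    show "E (x, z)"
    proof (rule E, rule ballI)
      fix d assume "d \<in> X"
      then have "d x z \<le> d x y + d y z" "d x y < e / 2" "d y z < e / 2"
        using X(2) triangle xy yz by auto
      then show "d x z < e" by simp
    qed
  qed
qed


section \<open>The pseudo-seminorm of a sequence of balanced sets\<close>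

text \<open>
  Threefold sums appear in \<open>add3_mem\<close> because the chain argument cuts a decomposition into a front
  part, a single vector and a back part.  \<open>U 0\<close> is the whole space so that the infimum
  defining \<open>level\<close> is over a nonempty set.
\<close>

locale balanced_sequence = vector_space scale
  for scale :: "'k::real_normed_field \<Rightarrow> 'a::ab_group_add \<Rightarrow> 'a" +
  fixes U :: "nat \<Rightarrow> 'a set"
  assumes U_0: "U 0 = UNIV"
    and zero_mem: "0 \<in> U n"
    and balanced: "norm c \<le> 1 \<Longrightarrow> x \<in> U n \<Longrightarrow> scale c x \<in> U n"
    and add3_mem: "x \<in> U (Suc n) \<Longrightarrow> y \<in> U (Suc n) \<Longrightarrow> z \<in> U (Suc n) \<Longrightarrow> x + y + z \<in> U n"
begin

definition level :: "'a \<Rightarrow> real" where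
  "level x = (INF n\<in>{n. x \<in> U n}. (1/2) ^ n)"

definition chain_norm :: "'a \<Rightarrow> real" where
  "chain_norm x = (INF xs\<in>{xs. sum_list xs = x}. sum_list (map level xs))"

lemma antimono_U: "m \<le> n \<Longrightarrow> U n \<subseteq> U m"
proof (rule lift_Suc_antimono_le)
  show "U (Suc n) \<subseteq> U n" for n
    using add3_mem[of _ n 0 0] zero_mem by auto
qed

lemma bdd_below_level: "bdd_below ((\<lambda>n. (1/2::real) ^ n) ` N)"
  by (rule bdd_belowI[of _ 0]) auto

lemma level_nonneg: "0 \<le> level x"
  unfolding level_def using U_0 by (intro cINF_greatest) auto

lemma level_le: "x \<in> U n \<Longrightarrow> level x \<le> (1/2) ^ n"
  unfolding level_def by (intro cINF_lower bdd_below_level) simp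

text \<open>
  Levels below \<open>2\<^sup>-\<^sup>n\<close> are at most \<open>2\<^sup>-\<^sup>n\<^sup>-\<^sup>1\<close>, which gains one index.  The chain argument
  spends this gain on the single vector at the cut.
\<close>

lemma mem_if_level_less:
  assumes "level x < (1/2) ^ n"
  shows "x \<in> U (Suc n)"
proof -
  have "{n. x \<in> U n} \<noteq> {}" using U_0 by auto
  with assms obtain m where m: "x \<in> U m" "(1/2::real) ^ m < (1/2) ^ n"
    unfolding level_def by (subst (asm) cINF_less_iff[OF _ bdd_below_level]) auto
  from m(2) have "n < m" by (simp add: power_strict_decreasing_iff)
  with m(1) antimono_U[of "Suc n" m] show ?thesis by auto
qed

lemma level_scale:
  assumes "norm c \<le> 1"
  shows "level (scale c x) \<le> level x"
  unfolding level_def[of x]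
  using U_0 balanced[OF assms] by (intro cINF_greatest level_le) auto

lemma sum_list_level_nonneg: "0 \<le> sum_list (map level xs)"
  by (rule sum_list_nonneg) (auto simp: level_nonneg)

text \<open>
  The vector \<open>y\<close> is the one at which the running total of the levels reaches \<open>t\<close>.
\<close>

lemma split_at_weight:
  assumes "xs \<noteq> []" "0 \<le> t" "t \<le> sum_list (map level xs)"
  shows "\<exists>as y bs. xs = as @ y # bs \<and> sum_list (map level as) \<le> t \<and>
           t \<le> sum_list (map level as) + level y"
  using assms
proof (induction xs arbitrary: t)
  case Nil
  then show ?case by simp
next
  case (Cons x xs)
  show ?case
  proof (cases "t \<le> level x")
    case True
    with Cons.prems show ?thesis
      by (intro exI[of _ "[]"] exI[of _ x] exI[of _ xs]) auto
  next
    case False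
    with Cons.prems have "xs \<noteq> []" "0 \<le> t - level x" "t - level x \<le> sum_list (map level xs)"
      by auto
    from Cons.IH[OF this] obtain as y bs where "xs = as @ y # bs"
      "sum_list (map level as) \<le> t - level x" "t - level x \<le> sum_list (map level as) + level y"
      by blast
    then show ?thesis
      by (intro exI[of _ "x # as"] exI[of _ y] exI[of _ bs]) auto
  qed
qed

text \<open>
  Frink's chain argument.  Cut the list where the running total passes half of the whole.  The
  front and the back part each have at most half of the total, so by induction they sum to
  elements of \<open>U (n+1)\<close>; the vector at the cut has level below \<open>2\<^sup>-\<^sup>n\<close> and so lies in \<open>U (n+1)\<close> as
  well.
\<close>

lemma sum_list_mem:
  assumes "sum_list (map level xs) < (1/2) ^ n"
  shows "sum_list xs \<in> U n"
  using assms
proof (induction "length xs" arbitrary: xs n rule: less_induct)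
  case less
  show ?case
  proof (cases "xs = []")
    case True
    then show ?thesis by (simp add: zero_mem)
  next
    case False
    let ?s = "sum_list (map level xs)"
    obtain as y bs where xs: "xs = as @ y # bs" and as: "sum_list (map level as) \<le> ?s / 2"
      and y: "?s / 2 \<le> sum_list (map level as) + level y"
      using split_at_weight[OF False, of "?s / 2"] sum_list_level_nonneg[of xs] by auto
    have s: "?s = sum_list (map level as) + level y + sum_list (map level bs)"
      by (simp add: xs)
    have "sum_list as \<in> U (Suc n)"
      using as less.prems by (intro less.hyps) (auto simp: xs)
    moreover have "sum_list bs \<in> U (Suc n)"
      using y s less.prems by (intro less.hyps) (auto simp: xs)
    moreover have "y \<in> U (Suc n)"
      using s less.prems sum_list_level_nonneg[of as] sum_list_level_nonneg[of bs]
      by (intro mem_if_level_less) linarith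
    ultimately show ?thesis
      using add3_mem[of "sum_list as" n y "sum_list bs"] by (simp add: xs add.assoc)
  qed
qed

lemma chain_norm_le: "chain_norm (sum_list xs) \<le> sum_list (map level xs)"
  unfolding chain_norm_def
  by (rule cINF_lower) (auto intro!: bdd_belowI[of _ 0] sum_list_level_nonneg)

lemma chain_norm_greatest:
  assumes "\<And>xs. sum_list xs = x \<Longrightarrow> t \<le> sum_list (map level xs)"
  shows "t \<le> chain_norm x"
  unfolding chain_norm_def
  by (rule cINF_greatest) (auto intro!: assms exI[of _ "[x]"])

lemma chain_norm_le_if_mem: "x \<in> U n \<Longrightarrow> chain_norm x \<le> (1/2) ^ n"
  using chain_norm_le[of "[x]"] level_le[of x n] by simp

text \<open>
  Together with the preceding estimate this shows that the balls of \<open>chain_norm\<close> and the sets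
  \<open>U n\<close> are cofinal in each other.
\<close>

lemma mem_if_chain_norm_less:
  assumes "chain_norm x < (1/2) ^ n"
  shows "x \<in> U n"
proof (rule ccontr)
  assume "x \<notin> U n"
  then have "(1/2) ^ n \<le> chain_norm x"
    using sum_list_mem by (intro chain_norm_greatest) (metis not_le)
  with assms show False by simp
qed

text \<open>
  Scaling a decomposition of \<open>x\<close> termwise gives one of \<open>c x\<close>, and concatenating decompositions
  of \<open>x\<close> and \<open>y\<close> gives one of \<open>x + y\<close>; the empty decomposition gives \<open>chain_norm 0 = 0\<close>.
\<close>

lemma pseudo_seminorm_chain_norm: "pseudo_seminorm scale chain_norm"
proof unfold_locales
  fix c :: 'k and x y :: 'a
  show "chain_norm (scale c x) \<le> chain_norm x" if c: "norm c \<le> 1"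
  proof (rule chain_norm_greatest)
    fix xs assume x: "sum_list xs = x"
    have "sum_list (map (scale c) xs) = scale c (sum_list xs)"
      by (induction xs) (auto simp: scale_right_distrib)
    then have "chain_norm (scale c x) \<le> sum_list (map level (map (scale c) xs))"
      using chain_norm_le[of "map (scale c) xs"] x by simp
    also have "\<dots> \<le> sum_list (map level xs)"
      unfolding map_map o_def by (rule sum_list_mono) (rule level_scale[OF c])
    finally show "chain_norm (scale c x) \<le> sum_list (map level xs)" .
  qed
  have "chain_norm (x + y) - sum_list (map level xs) \<le> chain_norm y" if "sum_list xs = x" for xs
  proof (rule chain_norm_greatest)
    fix ys assume "sum_list ys = y"
    then show "chain_norm (x + y) - sum_list (map level xs) \<le> sum_list (map level ys)"
      using chain_norm_le[of "xs @ ys"] that by simp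
  qed
  then have "chain_norm (x + y) - chain_norm y \<le> chain_norm x"
    by (intro chain_norm_greatest) (simp add: algebra_simps)
  then show "chain_norm (x + y) \<le> chain_norm x + chain_norm y" by simp
  show "chain_norm 0 = 0"
    using chain_norm_le[of "[]"] chain_norm_greatest[of 0 0] sum_list_level_nonneg
    by (intro antisym) auto
qed

end


section \<open>Neighbourhoods of zero in a topological vector space\<close>

context topological_vector_space
begin

definition nbhd_0 :: "'a set \<Rightarrow> bool" where
  "nbhd_0 N \<longleftrightarrow> (\<exists>V. openin T V \<and> 0 \<in> V \<and> V \<subseteq> N)"

lemma nbhd_0_mono: "nbhd_0 M \<Longrightarrow> M \<subseteq> N \<Longrightarrow> nbhd_0 N"
  unfolding nbhd_0_def by blast

lemma nbhd_0_inter: "nbhd_0 M \<Longrightarrow> nbhd_0 N \<Longrightarrow> nbhd_0 (M \<inter> N)"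
  unfolding nbhd_0_def by (meson IntI Int_mono openin_Int)

lemma nbhd_0_UNIV: "nbhd_0 UNIV"
  unfolding nbhd_0_def using openin_topspace[of T] topspace_eq by auto

lemma nbhd_0_INT: "finite X \<Longrightarrow> (\<And>p. p \<in> X \<Longrightarrow> nbhd_0 (N p)) \<Longrightarrow> nbhd_0 (\<Inter>p\<in>X. N p)"
  by (induction X rule: finite_induct) (auto simp: nbhd_0_UNIV nbhd_0_inter)

lemma continuous_map_scale: "continuous_map T T (scale c)"
proof -
  have "continuous_map T T ((\<lambda>(c, x). scale c x) \<circ> (\<lambda>x. (c, x)))"
    by (rule continuous_map_compose[OF _ continuous_scale])
       (simp add: continuous_map_pairwise o_def)
  then show ?thesis by (simp add: o_def)
qed

lemma openin_vimage_scale: "openin T V \<Longrightarrow> openin T (scale c -` V)"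
  using openin_continuous_map_preimage[OF continuous_map_scale]
  by (simp add: topspace_eq vimage_def)

lemma openin_vimage_diff:
  assumes "openin T V"
  shows "openin T ((\<lambda>y. x - y) -` V)"
proof -
  have "continuous_map T T ((\<lambda>(x, y). x + y) \<circ> (\<lambda>y. (x, scale (- 1) y)))"
    by (rule continuous_map_compose[OF _ continuous_add])
       (use continuous_map_scale[of "- 1"] in
         \<open>simp add: continuous_map_pairwise o_def topspace_eq del: scale_minus_left\<close>)
  from openin_continuous_map_preimage[OF this assms] show ?thesis
    by (simp add: topspace_eq vimage_def)
qed

text \<open>
  Translation invariance.  The reflected translate \<open>{z. x - z \<in> S}\<close>, in place of \<open>S - x\<close>, matches
  the pseudometric \<open>p (x - y)\<close>, in which \<open>y\<close> is subtracted from the centre.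
\<close>

lemma openin_iff_nbhd_0: "openin T S \<longleftrightarrow> (\<forall>x\<in>S. nbhd_0 {z. x - z \<in> S})"
proof
  assume "openin T S"
  show "\<forall>x\<in>S. nbhd_0 {z. x - z \<in> S}"
  proof
    fix x assume "x \<in> S"
    then show "nbhd_0 {z. x - z \<in> S}"
      unfolding nbhd_0_def using openin_vimage_diff[OF \<open>openin T S\<close>, of x]
      by (intro exI[of _ "(\<lambda>y. x - y) -` S"]) auto
  qed
next
  assume R: "\<forall>x\<in>S. nbhd_0 {z. x - z \<in> S}"
  show "openin T S"
  proof (subst openin_subopen, rule ballI)
    fix x assume "x \<in> S"
    with R obtain V where V: "openin T V" "0 \<in> V" "V \<subseteq> {z. x - z \<in> S}"
      unfolding nbhd_0_def by blast
    have "(\<lambda>y. x - y) -` V \<subseteq> S"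
    proof
      fix y assume "y \<in> (\<lambda>y. x - y) -` V"
      then have "x - (x - y) \<in> S" using V(3) by blast
      then show "y \<in> S" by simp
    qed
    then show "\<exists>W. openin T W \<and> x \<in> W \<and> W \<subseteq> S"
      using openin_vimage_diff[OF V(1)] V(2) by (intro exI[of _ "(\<lambda>y. x - y) -` V"]) auto
  qed
qed

lemma nbhd_0_halve:
  assumes "nbhd_0 N"
  shows "\<exists>M. nbhd_0 M \<and> (\<forall>x\<in>M. \<forall>y\<in>M. x + y \<in> N)"
proof -
  from assms obtain V where V: "openin T V" "0 \<in> V" "V \<subseteq> N"
    unfolding nbhd_0_def by blast
  have "openin (prod_topology T T) {z. (case z of (x, y) \<Rightarrow> x + y) \<in> V}"
    using openin_continuous_map_preimage[OF continuous_add V(1)] by (simp add: topspace_eq)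
  then obtain A B where AB: "openin T A" "openin T B" "0 \<in> A" "0 \<in> B"
    "A \<times> B \<subseteq> {z. (case z of (x, y) \<Rightarrow> x + y) \<in> V}"
    using V(2) unfolding openin_prod_topology_alt
    by (elim allE[of _ 0] impE exE conjE) (simp, blast)
  show ?thesis
  proof (intro exI conjI)
    show "nbhd_0 (A \<inter> B)"
      using AB unfolding nbhd_0_def by (intro exI[of _ "A \<inter> B"]) auto
    show "\<forall>x\<in>A \<inter> B. \<forall>y\<in>A \<inter> B. x + y \<in> N"
      using AB(5) V(3) by fast
  qed
qed

text \<open>
  By continuity of scalar multiplication at \<open>(0, 0)\<close> there are \<open>r > 0\<close> and a neighbourhood \<open>B\<close> of
  \<open>0\<close> such that all \<open>scale a b\<close> with \<open>norm a < r\<close> and \<open>b \<in> B\<close> lie in \<open>N\<close>.  These products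
  form a balanced set, and it contains the neighbourhood \<open>(r/2) B\<close> of \<open>0\<close>.
\<close>

lemma nbhd_0_balanced:
  assumes "nbhd_0 N"
  shows "\<exists>M. nbhd_0 M \<and> M \<subseteq> N \<and> (\<forall>c x. norm c \<le> 1 \<longrightarrow> x \<in> M \<longrightarrow> scale c x \<in> M)"
proof -
  from assms obtain V where V: "openin T V" "0 \<in> V" "V \<subseteq> N"
    unfolding nbhd_0_def by blast
  have "openin (prod_topology euclidean T) {z. (case z of (c, x) \<Rightarrow> scale c x) \<in> V}"
    using openin_continuous_map_preimage[OF continuous_scale V(1)] by (simp add: topspace_eq)
  then obtain A B where AB: "open A" "openin T B" "0 \<in> A" "0 \<in> B"
    "A \<times> B \<subseteq> {z. (case z of (c, x) \<Rightarrow> scale c x) \<in> V}"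
    using V(2) unfolding openin_prod_topology_alt open_openin[symmetric]
    by (elim allE[of _ 0] impE exE conjE) (simp, blast)
  from AB(1,3) obtain r where r: "r > 0" "ball 0 r \<subseteq> A"
    by (meson openE)
  define M where "M = (\<lambda>(c, x). scale c x) ` (ball 0 r \<times> B)"
  show ?thesis
  proof (intro exI conjI allI impI)
    show "M \<subseteq> N"
      using r AB(5) V(3) unfolding M_def by fast
    define c :: 'k where "c = of_real (r / 2)"
    have c: "c \<noteq> 0" "c \<in> ball 0 r" using r by (auto simp: c_def)
    have "scale (inverse c) -` B \<subseteq> M"
    proof
      fix x assume "x \<in> scale (inverse c) -` B"
      then have "scale c (scale (inverse c) x) \<in> M"
        using c unfolding M_def by force
      then show "x \<in> M" using c by simp
    qed
    then show "nbhd_0 M"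
      unfolding nbhd_0_def using openin_vimage_scale[OF AB(2)] AB(4)
      by (intro exI[of _ "scale (inverse c) -` B"]) auto
    fix c :: 'k and x assume c: "norm c \<le> 1" and "x \<in> M"
    then obtain a b where ab: "x = scale a b" "norm a < r" "b \<in> B" unfolding M_def by auto
    have "norm (c * a) < r"
      using c ab(2) mult_right_mono[OF c norm_ge_zero[of a]] by (simp add: norm_mult)
    then show "scale c x \<in> M"
      unfolding M_def using ab by force
  qed
qed

text \<open>
  Halving twice gives \<open>B + B \<subseteq> A\<close> and \<open>A + A \<subseteq> N\<close>, so that \<open>B + B + A \<subseteq> N\<close>.
\<close>

lemma nbhd_0_balanced_third:
  assumes "nbhd_0 N"
  shows "\<exists>M. nbhd_0 M \<and> (\<forall>c x. norm c \<le> 1 \<longrightarrow> x \<in> M \<longrightarrow> scale c x \<in> M) \<and>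
           (\<forall>x\<in>M. \<forall>y\<in>M. \<forall>z\<in>M. x + y + z \<in> N)"
proof -
  obtain A where A: "nbhd_0 A" "\<And>x y. x \<in> A \<Longrightarrow> y \<in> A \<Longrightarrow> x + y \<in> N"
    using nbhd_0_halve[OF assms] by blast
  obtain B where B: "nbhd_0 B" "\<And>x y. x \<in> B \<Longrightarrow> y \<in> B \<Longrightarrow> x + y \<in> A"
    using nbhd_0_halve[OF A(1)] by blast
  obtain M where M: "nbhd_0 M" "M \<subseteq> A \<inter> B" "\<forall>c x. norm c \<le> 1 \<longrightarrow> x \<in> M \<longrightarrow> scale c x \<in> M"
    using nbhd_0_balanced[OF nbhd_0_inter[OF A(1) B(1)]] by blast
  have "x + y + z \<in> N" if "x \<in> M" "y \<in> M" "z \<in> M" for x y z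
  proof (rule A(2))
    show "x + y \<in> A" "z \<in> A" using that M(2) B(2) by auto
  qed
  with M(1,3) show ?thesis by (intro exI[of _ M] conjI) auto
qed

definition continuous_pseudo_seminorms :: "('a \<Rightarrow> real) set" where
  "continuous_pseudo_seminorms = {p. pseudo_seminorm scale p \<and> (\<forall>e>0. nbhd_0 {x. p x < e})}"

lemma nbhd_0_contains_ball:
  assumes "nbhd_0 N"
  shows "\<exists>p\<in>continuous_pseudo_seminorms. \<exists>e>0. {x. p x < e} \<subseteq> N"
proof -
  \<comment> \<open>The case \<open>n = 0\<close> is separate because the sequence must start with the whole space.\<close>
  let ?good = "\<lambda>n M. nbhd_0 M \<and> (\<forall>c x. norm c \<le> 1 \<longrightarrow> x \<in> M \<longrightarrow> scale c x \<in> M) \<and>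
    (if n = 0 then M = UNIV else M \<subseteq> N)"
  have "\<exists>U. \<forall>n::nat. ?good n (U n) \<and>
      (\<forall>x\<in>U (Suc n). \<forall>y\<in>U (Suc n). \<forall>z\<in>U (Suc n). x + y + z \<in> U n)"
  proof (rule dependent_nat_choice)
    show "\<exists>M. ?good 0 M" using nbhd_0_UNIV by auto
    fix M and n :: nat assume "?good n M"
    then have "nbhd_0 (M \<inter> N)" using assms nbhd_0_inter by blast
    then obtain L where L: "nbhd_0 L" "\<forall>c x. norm c \<le> 1 \<longrightarrow> x \<in> L \<longrightarrow> scale c x \<in> L"
      "\<forall>x\<in>L. \<forall>y\<in>L. \<forall>z\<in>L. x + y + z \<in> M \<inter> N"
      using nbhd_0_balanced_third by blast
    have "0 \<in> L" using L(1) by (auto simp: nbhd_0_def)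
    have "L \<subseteq> N"
    proof
      fix x assume "x \<in> L"
      then have "x + 0 + 0 \<in> N" using L(3) \<open>0 \<in> L\<close> by blast
      then show "x \<in> N" by simp
    qed
    then show "\<exists>L. ?good (Suc n) L \<and> (\<forall>x\<in>L. \<forall>y\<in>L. \<forall>z\<in>L. x + y + z \<in> M)"
      using L by (intro exI[of _ L]) auto
  qed
  then obtain U where U: "\<And>n. ?good n (U n)"
    and U3: "\<And>n x y z. x \<in> U (Suc n) \<Longrightarrow> y \<in> U (Suc n) \<Longrightarrow> z \<in> U (Suc n) \<Longrightarrow> x + y + z \<in> U n"
    by blast
  interpret U: balanced_sequence scale U
  proof
    show "U 0 = UNIV" using U[of 0] by simp
    show "0 \<in> U n" for n using U[of n] by (auto simp: nbhd_0_def)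
  qed (use U U3 in blast)+
  have "nbhd_0 {x. U.chain_norm x < e}" if e: "e > 0" for e
  proof -
    obtain n where n: "(1/2) ^ n < e"
      using real_arch_pow_inv[OF e, of "1/2"] by auto
    have "U n \<subseteq> {x. U.chain_norm x < e}"
      using U.chain_norm_le_if_mem[of _ n] n by (auto intro: le_less_trans)
    then show ?thesis using U[of n] nbhd_0_mono by blast
  qed
  then have "U.chain_norm \<in> continuous_pseudo_seminorms"
    by (simp add: continuous_pseudo_seminorms_def U.pseudo_seminorm_chain_norm)
  moreover have "{x. U.chain_norm x < 1/2} \<subseteq> N"
    using U.mem_if_chain_norm_less[of _ 1] U[of 1] by auto
  ultimately show ?thesis by (intro bexI[of _ U.chain_norm] exI[of _ "1/2"]) auto
qed

text \<open>
  A set is open in either topology iff it is a neighbourhood of each of its points \<open>x\<close>, so the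
  neighbourhoods of \<open>x\<close> are compared.  A given neighbourhood contains a ball of a single
  pseudo-seminorm; conversely, a finite intersection of balls of continuous pseudo-seminorms is a
  neighbourhood.
\<close>

theorem topology_eq_pseudometrics_topology:
  "T = pseudometrics_topology (pseudometric_of ` continuous_pseudo_seminorms)"
  unfolding topology_eq
proof
  fix S
  have "nbhd_0 {z. x - z \<in> S} \<longleftrightarrow>
      (\<exists>X e. finite X \<and> X \<subseteq> pseudometric_of ` continuous_pseudo_seminorms \<and> 0 < e \<and>
         (\<forall>y. (\<forall>d\<in>X. d x y < e) \<longrightarrow> y \<in> S))" (is "_ \<longleftrightarrow> ?R") for x
  proof
    assume "nbhd_0 {z. x - z \<in> S}"
    from nbhd_0_contains_ball[OF this] obtain p e where
      p: "p \<in> continuous_pseudo_seminorms" "e > 0" "{z. p z < e} \<subseteq> {z. x - z \<in> S}" by blast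
    have "y \<in> S" if "p (x - y) < e" for y
    proof -
      from that p(3) have "x - (x - y) \<in> S" by blast
      then show ?thesis by simp
    qed
    then show ?R
      using p by (intro exI[of _ "{pseudometric_of p}"] exI[of _ e]) (auto simp: pseudometric_of_def)
  next
    assume ?R
    then obtain X e where X: "finite X" "X \<subseteq> pseudometric_of ` continuous_pseudo_seminorms"
      "0 < e" "\<And>y. (\<forall>d\<in>X. d x y < e) \<Longrightarrow> y \<in> S" by blast
    from X(1,2) obtain Q where Q: "finite Q" "Q \<subseteq> continuous_pseudo_seminorms"
      "X = pseudometric_of ` Q" by (meson finite_subset_image)
    have "nbhd_0 (\<Inter>p\<in>Q. {z. p z < e})"
      using Q X(3) by (intro nbhd_0_INT) (auto simp: continuous_pseudo_seminorms_def)
    moreover have "(\<Inter>p\<in>Q. {z. p z < e}) \<subseteq> {z. x - z \<in> S}"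
      using X(4) Q(3) by (auto simp: pseudometric_of_def)
    ultimately show "nbhd_0 {z. x - z \<in> S}" by (rule nbhd_0_mono)
  qed
  then show "openin T S \<longleftrightarrow>
      openin (pseudometrics_topology (pseudometric_of ` continuous_pseudo_seminorms)) S"
    unfolding openin_iff_nbhd_0 openin_pseudometrics_topology by simp
qed

theorem ex_pseudo_seminorms_and_uniformizable:
  "(\<exists>P. (\<forall>p\<in>P. pseudo_seminorm scale p) \<and> T = pseudometrics_topology (pseudometric_of ` P)) \<and>
   uniformizable T"
proof
  have P: "\<forall>p\<in>continuous_pseudo_seminorms. pseudo_seminorm scale p"
    by (simp add: continuous_pseudo_seminorms_def)
  show "\<exists>P. (\<forall>p\<in>P. pseudo_seminorm scale p) \<and> T = pseudometrics_topology (pseudometric_of ` P)"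
    by (rule exI[of _ continuous_pseudo_seminorms])
       (rule conjI[OF P topology_eq_pseudometrics_topology])
  have "uniformizable (pseudometrics_topology (pseudometric_of ` continuous_pseudo_seminorms))"
  proof (rule uniformizable_pseudometrics_topology; elim imageE; clarify)
    fix p assume "p \<in> continuous_pseudo_seminorms"
    then interpret pseudo_seminorm scale p using P by blast
    show "pseudometric_of p x x = 0" for x
      by (rule pseudometric_of_refl)
    show "pseudometric_of p x y = pseudometric_of p y x" for x y
      by (rule pseudometric_of_sym)
    show "pseudometric_of p x z \<le> pseudometric_of p x y + pseudometric_of p y z" for x y z
      by (rule pseudometric_of_triangle)
  qed
  then show "uniformizable T"
    by (rule ssubst[OF topology_eq_pseudometrics_topology])
qed

end


section \<open>Real and complex topological vector spaces\<close>

theorem theorem2p3: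
  fixes scale_real :: "real \<Rightarrow> 'a::ab_group_add \<Rightarrow> 'a" and T_real :: "'a topology"
    and scale_complex :: "complex \<Rightarrow> 'b::ab_group_add \<Rightarrow> 'b" and T_complex :: "'b topology"
  shows "(topological_vector_space scale_real T_real \<longrightarrow>
           (\<exists>P. (\<forall>p\<in>P. pseudo_seminorm scale_real p) \<and>
                T_real = pseudometrics_topology (pseudometric_of ` P)) \<and>
           uniformizable T_real) \<and>
         (topological_vector_space scale_complex T_complex \<longrightarrow>
           (\<exists>P. (\<forall>p\<in>P. pseudo_seminorm scale_complex p) \<and>
                T_complex = pseudometrics_topology (pseudometric_of ` P)) \<and>
           uniformizable T_complex)"
  by (rule conjI; rule impI; rule topological_vector_space.ex_pseudo_seminorms_and_uniformizable)

end
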